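(* The reduction $\longrightarrow$ of the untyped computational $\lambda$-calculus $\lambda_c^u$ is Church–Rosser: for all computations $M,N,L$, if $M\longrightarrow^* N$ and $M\longrightarrow^* L$, then there exists a computation $M'$ with $N\longrightarrow^* M'$ and $L\longrightarrow^* M'$.
   Context: The calculus $\lambda_c^u$ has two sorts of expressions over a denumerable set of variables $x$: values $V,W ::= x \mid \lambda x.M$ and computations $M,N ::= \mathit{unit}\,V \mid M\star V$ (terms are identified up to renaming of bound variables; $M[V/x]$ is capture-avoiding substitution; $FV$ denotes free variables). The notion of reduction $\lambda\mathbf{C}=\beta_c\cup \mathit{id}\cup \mathit{ass}$ consists of the pairs of computations: $(\beta_c)$ $\mathit{unit}\,V\star(\lambda x.M) \mapsto M[V/x]$; $(\mathit{id})$ $M\star \lambda x.\mathit{unit}\,x \mapsto M$; $(\mathit{ass})$ $(L\star\lambda x.M)\star\lambda y.N \mapsto L\star \lambda x.(M\star\lambda y.N)$ provided $x\notin FV(N)$. Value contexts are $\mathcal V ::= [\cdot]_D \mid \lambda x.\mathcal C$ and computation contexts are $\mathcal C ::= [\cdot]_{TD}\mid \mathit{unit}\,\mathcal V \mid \mathcal C\star V \mid M\star \mathcal V$ (holes filled by values resp. computations, possibly capturing variables). The one-step reduction $\longrightarrow$ is the compatible closure of $\lambda\mathbf C$: if $(M,M')\in\lambda\mathbf C$ then $\mathcal C[M]\longrightarrow \mathcal C[M']$ for every computation context $\mathcal C$. $\longrightarrow^*$ is its reflexive–transitive closure. *)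

theory Defs
  imports Main
begin

text \<open>
  Terms up to renaming of bound variables are represented with de Bruijn indices:
  \<open>Var i\<close> is bound by the \<open>i\<close>-th enclosing \<open>Lam\<close>, counting from 0, and
  is free if there is no such binder.
\<close>

datatype val = Var nat | Lam com
  and com = Unit val | Bind com val (infixl "\<star>" 70)

text \<open>Renaming that makes room for one additional binder at index \<open>k\<close>.\<close>

primrec lift_val :: "val \<Rightarrow> nat \<Rightarrow> val" and lift_com :: "com \<Rightarrow> nat \<Rightarrow> com" where
  "lift_val (Var i) k = (if i < k then Var i else Var (Suc i))"
| "lift_val (Lam M) k = Lam (lift_com M (Suc k))"
| "lift_com (Unit V) k = Unit (lift_val V k)"
| "lift_com (M \<star> V) k = lift_com M k \<star> lift_val V k"

text \<open>
  Capture-avoiding substitution for index \<open>k\<close>, whose binder disappears: larger indices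
  are decremented. For a redex \<open>Unit V \<star> Lam M\<close>, the contractum \<open>M[V/x]\<close> is
  \<open>subst_com M V 0\<close>.
\<close>

primrec subst_val :: "val \<Rightarrow> val \<Rightarrow> nat \<Rightarrow> val" and subst_com :: "com \<Rightarrow> val \<Rightarrow> nat \<Rightarrow> com" where
  "subst_val (Var i) V k = (if k < i then Var (i - 1) else if i = k then V else Var i)"
| "subst_val (Lam M) V k = Lam (subst_com M (lift_val V 0) (Suc k))"
| "subst_com (Unit W) V k = Unit (subst_val W V k)"
| "subst_com (M \<star> W) V k = subst_com M V k \<star> subst_val W V k"

text \<open>
  In rule \<open>ass\<close>, \<open>N\<close> moves under the binder \<open>x\<close>, which then encloses the
  binder \<open>y\<close> (index 0) of \<open>N\<close>. Lifting at 1 gives \<open>x\<close> the index 1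
  in \<open>N\<close>, where it does not occur; this is the side condition that \<open>x\<close> is
  not free in \<open>N\<close>.
\<close>

inductive lambdaC :: "com \<Rightarrow> com \<Rightarrow> bool" where
  beta_c: "lambdaC (Unit V \<star> Lam M) (subst_com M V 0)"
| ident: "lambdaC (M \<star> Lam (Unit (Var 0))) M"
| ass: "lambdaC ((L \<star> Lam M) \<star> Lam N) (L \<star> Lam (M \<star> Lam (lift_com N 1)))"

datatype vctx = VHole | CtxLam cctx
  and cctx = CHole | CtxUnit vctx | CtxBindL cctx val | CtxBindR com vctx

text \<open>
  \<open>fill_cctx C M P\<close> states that \<open>P\<close> is \<open>C[M]\<close> for a computation \<open>M\<close>.
  Filling is partial, since the value hole does not accept a computation. No lifting takes
  place under \<open>CtxLam\<close>: contexts may capture variables of \<open>M\<close>.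
\<close>

inductive fill_vctx :: "vctx \<Rightarrow> com \<Rightarrow> val \<Rightarrow> bool" and fill_cctx :: "cctx \<Rightarrow> com \<Rightarrow> com \<Rightarrow> bool" where
  "fill_cctx C M P \<Longrightarrow> fill_vctx (CtxLam C) M (Lam P)"
| "fill_cctx CHole M M"
| "fill_vctx E M V \<Longrightarrow> fill_cctx (CtxUnit E) M (Unit V)"
| "fill_cctx C M P \<Longrightarrow> fill_cctx (CtxBindL C V) M (P \<star> V)"
| "fill_vctx E M V \<Longrightarrow> fill_cctx (CtxBindR N E) M (N \<star> V)"

inductive red :: "com \<Rightarrow> com \<Rightarrow> bool" (infix "\<longlongrightarrow>\<^sub>c" 50) where
  "lambdaC M M' \<Longrightarrow> fill_cctx C M P \<Longrightarrow> fill_cctx C M' P' \<Longrightarrow> P \<longlongrightarrow>\<^sub>c P'"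

abbreviation reds :: "com \<Rightarrow> com \<Rightarrow> bool" (infix "\<longlongrightarrow>\<^sub>c*" 50) where
  "reds \<equiv> red\<^sup>*\<^sup>*"

end

theory Submission
  imports Defs
begin

text \<open>
  By the Hindley--Rosen lemma it suffices that \<open>ass\<close> and \<open>\<beta>\<^sub>c \<union> id\<close> are each confluent and
  commute. A superdevelopment map with the Z property (\<open>M \<rightarrow> N\<close> implies
  \<open>N \<rightarrow>\<^sup>* M\<^sup>\<bullet> \<rightarrow>\<^sup>* N\<^sup>\<bullet>\<close>) gives confluence of \<open>\<beta>\<^sub>c \<union> id\<close>. For \<open>ass\<close> the Z map is a
  recursively computed normal form, which \<open>ass\<close>-steps leave unchanged because grafting
  normal forms is associative. Finally, \<open>ass\<close> is linear, so an \<open>ass\<close>-step never duplicates a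
  \<open>\<beta>\<^sub>c\<close>- or \<open>id\<close>-redex and local commutation already implies commutation.
\<close>

section \<open>Abstract rewriting\<close>

definition commuting :: "('a \<Rightarrow> 'a \<Rightarrow> bool) \<Rightarrow> ('a \<Rightarrow> 'a \<Rightarrow> bool) \<Rightarrow> bool" where
  "commuting r s \<longleftrightarrow> (\<forall>x y z. r x y \<longrightarrow> s x z \<longrightarrow> (\<exists>u. s y u \<and> r z u))"

lemma commutingD: "commuting r s \<Longrightarrow> r x y \<Longrightarrow> s x z \<Longrightarrow> \<exists>u. s y u \<and> r z u"
  unfolding commuting_def by blast

lemma commuting_sym: "commuting r s \<Longrightarrow> commuting s r"
  unfolding commuting_def by blast

text \<open>An s-step pushed across an r-step remains at most one s-step, so by induction it crosses
  a whole r-sequence (\<open>strip\<close>). The s-sequence is then pushed across one step at a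
  time.\<close>

lemma commuting_rtranclp:
  assumes local: "\<And>x y z. r x y \<Longrightarrow> s x z \<Longrightarrow> \<exists>u. s\<^sup>=\<^sup>= y u \<and> r\<^sup>*\<^sup>* z u"
  shows "commuting r\<^sup>*\<^sup>* s\<^sup>*\<^sup>*"
proof -
  have strip: "\<exists>u. s\<^sup>=\<^sup>= y u \<and> r\<^sup>*\<^sup>* z u" if "r\<^sup>*\<^sup>* x y" "s x z" for x y z
    using that
  proof (induction rule: rtranclp_induct)
    case base
    then show ?case by auto
  next
    case (step y y')
    then obtain u where u: "s\<^sup>=\<^sup>= y u" "r\<^sup>*\<^sup>* z u" by blast
    show ?case
    proof (cases "y = u")
      case True
      then have "r\<^sup>*\<^sup>* z y'" using u step.hyps by auto
      then show ?thesis by auto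
    next
      case False
      then have "s y u" using u by auto
      then obtain w where "s\<^sup>=\<^sup>= y' w" "r\<^sup>*\<^sup>* u w" using local step.hyps by blast
      then show ?thesis using u by (meson rtranclp_trans)
    qed
  qed
  have "\<exists>u. s\<^sup>*\<^sup>* y u \<and> r\<^sup>*\<^sup>* z u" if "s\<^sup>*\<^sup>* x z" "r\<^sup>*\<^sup>* x y" for x y z
    using that
  proof (induction rule: rtranclp_induct)
    case base
    then show ?case by auto
  next
    case (step z z')
    then obtain u where u: "s\<^sup>*\<^sup>* y u" "r\<^sup>*\<^sup>* z u" by blast
    then obtain w where "s\<^sup>=\<^sup>= u w" "r\<^sup>*\<^sup>* z' w" using strip step.hyps by blast
    moreover from this u have "s\<^sup>*\<^sup>* y w" by (auto intro: rtranclp.rtrancl_into_rtrancl)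
    ultimately show ?case by blast
  qed
  then show ?thesis unfolding commuting_def by blast
qed

text \<open>The union \<open>?t\<close> of the two closures has the diamond property: each
  combination of sides is one of the assumptions, the mixed one being read in both directions.
  Moreover \<open>?t\<close> has the same reflexive-transitive closure as
  \<open>sup r s\<close>.\<close>

lemma Hindley_Rosen:
  assumes "commuting r\<^sup>*\<^sup>* r\<^sup>*\<^sup>*" "commuting s\<^sup>*\<^sup>* s\<^sup>*\<^sup>*" "commuting r\<^sup>*\<^sup>* s\<^sup>*\<^sup>*"
  shows "commuting (sup r s)\<^sup>*\<^sup>* (sup r s)\<^sup>*\<^sup>*"
proof -
  let ?t = "sup r\<^sup>*\<^sup>* s\<^sup>*\<^sup>*"
  have "\<exists>u. ?t y u \<and> ?t z u" if "?t x y" "?t x z" for x y z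
    using that assms commuting_sym[OF assms(3)] unfolding commuting_def sup_fun_def sup_bool_def
    by meson
  then have "commuting ?t\<^sup>*\<^sup>* ?t\<^sup>*\<^sup>*"
    by (intro commuting_rtranclp) blast
  then show ?thesis by (simp add: rtranclp_sup_rtranclp)
qed

lemma commuting_if_Z:
  assumes Z1: "\<And>x y. r x y \<Longrightarrow> r\<^sup>*\<^sup>* y (f x)"
    and Z2: "\<And>x y. r x y \<Longrightarrow> r\<^sup>*\<^sup>* (f x) (f y)"
  shows "commuting r\<^sup>*\<^sup>* r\<^sup>*\<^sup>*"
proof -
  have mono: "r\<^sup>*\<^sup>* (f x) (f y)" if "r\<^sup>*\<^sup>* x y" for x y
    using that by (induction rule: rtranclp_induct) (auto intro: Z2 rtranclp_trans)
  have strip: "\<exists>u. r\<^sup>*\<^sup>* y u \<and> r\<^sup>*\<^sup>* z u" if "r x y" "r\<^sup>*\<^sup>* x z" for x y z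
    using that(2)
  proof (cases rule: rtranclp.cases)
    case rtrancl_refl
    then show ?thesis using that(1) by auto
  next
    case (rtrancl_into_rtrancl z')
    \<comment> \<open>The common reduct is \<open>f z'\<close>: \<open>y\<close> reaches
      \<open>f x\<close> and then \<open>f z'\<close> by \<open>mono\<close>, while \<open>z\<close>
      reaches \<open>f z'\<close> by \<open>Z1\<close> for the last step.\<close>
    then show ?thesis using mono Z1 that(1) by (meson rtranclp_trans)
  qed
  have "\<exists>u. r\<^sup>*\<^sup>* y u \<and> r\<^sup>*\<^sup>* z u" if "r\<^sup>*\<^sup>* x y" "r\<^sup>*\<^sup>* x z" for x y z
    using that
  proof (induction rule: rtranclp_induct)
    case base
    then show ?case by auto
  next
    case (step y y')
    then obtain u where u: "r\<^sup>*\<^sup>* y u" "r\<^sup>*\<^sup>* z u" by blast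
    then obtain w where "r\<^sup>*\<^sup>* y' w" "r\<^sup>*\<^sup>* u w" using strip step.hyps by blast
    then show ?case using u by (meson rtranclp_trans)
  qed
  then show ?thesis unfolding commuting_def by blast
qed

section \<open>Lifting and substitution\<close>

lemma lift_lift:
  "i \<le> k \<Longrightarrow> lift_val (lift_val V i) (Suc k) = lift_val (lift_val V k) i"
  "i \<le> k \<Longrightarrow> lift_com (lift_com M i) (Suc k) = lift_com (lift_com M k) i"
  by (induct V and M arbitrary: i k and i k) auto

lemma lift_subst:
  "j \<le> i \<Longrightarrow> lift_val (subst_val V W j) i = subst_val (lift_val V (Suc i)) (lift_val W i) j"
  "j \<le> i \<Longrightarrow> lift_com (subst_com M W j) i = subst_com (lift_com M (Suc i)) (lift_val W i) j"
  by (induct V and M arbitrary: i j W and i j W) (auto simp: lift_lift)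

lemma lift_subst_lt:
  "i \<le> j \<Longrightarrow> lift_val (subst_val V W j) i = subst_val (lift_val V i) (lift_val W i) (Suc j)"
  "i \<le> j \<Longrightarrow> lift_com (subst_com M W j) i = subst_com (lift_com M i) (lift_val W i) (Suc j)"
  by (induct V and M arbitrary: i j W and i j W) (auto simp: lift_lift)

lemma subst_lift [simp]:
  "subst_val (lift_val V k) W k = V"
  "subst_com (lift_com M k) W k = M"
  by (induct V and M arbitrary: k W and k W) auto

text \<open>The substitution lemma \<open>M[W/y][U[W/y]/x] = M[U/x][W/y]\<close> in de Bruijn
  form.\<close>

lemma subst_subst:
  "i \<le> j \<Longrightarrow> subst_val (subst_val V (lift_val W i) (Suc j)) (subst_val U W j) i
    = subst_val (subst_val V U i) W j"
  "i \<le> j \<Longrightarrow> subst_com (subst_com M (lift_val W i) (Suc j)) (subst_val U W j) i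
    = subst_com (subst_com M U i) W j"
  by (induct V and M arbitrary: i j U W and i j U W)
    (auto simp: lift_lift[symmetric] lift_subst_lt)

text \<open>After the lift, index \<open>Suc k\<close> is vacant, so decrementing the indices above
  \<open>k\<close> undoes it while \<open>k\<close> is replaced by itself. With \<open>k = 0\<close>
  this evaluates the beta-redex that arises in the overlap of ass and id.\<close>

lemma subst_lift_var_same:
  "subst_val (lift_val V (Suc k)) (Var k) k = V"
  "subst_com (lift_com M (Suc k)) (Var k) k = M"
  by (induct V and M arbitrary: k and k) auto

section \<open>Compatible closure\<close>

text \<open>Rules in place of contexts give direct induction on a step, and the parameter
  \<open>R\<close> lets ass and the union of beta and id share all closure lemmas.\<close>

inductive step_val :: "(com \<Rightarrow> com \<Rightarrow> bool) \<Rightarrow> val \<Rightarrow> val \<Rightarrow> bool"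
  and step_com :: "(com \<Rightarrow> com \<Rightarrow> bool) \<Rightarrow> com \<Rightarrow> com \<Rightarrow> bool" for R where
  step_Lam: "step_com R M M' \<Longrightarrow> step_val R (Lam M) (Lam M')"
| step_root: "R M M' \<Longrightarrow> step_com R M M'"
| step_Unit: "step_val R V V' \<Longrightarrow> step_com R (Unit V) (Unit V')"
| step_BindL: "step_com R M M' \<Longrightarrow> step_com R (M \<star> V) (M' \<star> V)"
| step_BindR: "step_val R V V' \<Longrightarrow> step_com R (M \<star> V) (M \<star> V')"

inductive_cases step_VarE [elim!]: "step_val R (Var i) V"
inductive_cases step_LamE [elim!]: "step_val R (Lam M) V"

lemma step_UnitE:
  assumes "step_com R (Unit V) P"
  obtains (root) "R (Unit V) P" | (arg) V' where "P = Unit V'" "step_val R V V'"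
  using assms by (cases rule: step_com.cases) auto

lemma step_BindE:
  assumes "step_com R (M \<star> V) P"
  obtains (root) "R (M \<star> V) P"
  | (left) M' where "P = M' \<star> V" "step_com R M M'"
  | (right) V' where "P = M \<star> V'" "step_val R V V'"
  using assms by (cases rule: step_com.cases) auto

lemma step_mono:
  assumes "R \<le> S"
  shows "step_val R V V' \<Longrightarrow> step_val S V V'" "step_com R M M' \<Longrightarrow> step_com S M M'"
  by (induction rule: step_val_step_com.inducts)
    (use assms in \<open>auto intro: step_val_step_com.intros\<close>)

text \<open>A step contains exactly one root contraction, which belongs to \<open>R\<close> or to
  \<open>S\<close>.\<close>

lemma step_sup: "step_com (sup R S) = sup (step_com R) (step_com S)"
proof (intro ext iffI)
  have "step_val (sup R S) V V' \<Longrightarrow> step_val R V V' \<or> step_val S V V'"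
    "step_com (sup R S) M M' \<Longrightarrow> step_com R M M' \<or> step_com S M M'" for V V' M M'
    by (induction rule: step_val_step_com.inducts) (auto intro: step_val_step_com.intros)
  then show "step_com (sup R S) M M' \<Longrightarrow> sup (step_com R) (step_com S) M M'" for M M'
    by auto
  show "sup (step_com R) (step_com S) M M' \<Longrightarrow> step_com (sup R S) M M'" for M M'
    using step_mono(2)[of R "sup R S"] step_mono(2)[of S "sup R S"] by auto
qed

section \<open>Context filling agrees with the compatible closure\<close>

inductive_cases fill_invs:
  "fill_vctx (CtxLam C) M V"
  "fill_cctx CHole M P"
  "fill_cctx (CtxUnit E) M P"
  "fill_cctx (CtxBindL C V) M P"
  "fill_cctx (CtxBindR N E) M P"

lemma red_eq_step: "red = step_com lambdaC"
proof (intro ext iffI)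
  fix P P'
  \<comment> \<open>Induction on the first filling; the second is inverted along the same
    context.\<close>
  have "fill_vctx E M V \<Longrightarrow> fill_vctx E M' V' \<Longrightarrow> lambdaC M M' \<Longrightarrow> step_val lambdaC V V'"
    "fill_cctx C M P \<Longrightarrow> fill_cctx C M' P' \<Longrightarrow> lambdaC M M' \<Longrightarrow> step_com lambdaC P P'"
    for E C M M' V V' P P'
    by (induction arbitrary: V' and P' rule: fill_vctx_fill_cctx.inducts)
      (auto elim!: fill_invs intro: step_val_step_com.intros)
  then show "red P P' \<Longrightarrow> step_com lambdaC P P'"
    by (metis red.cases)
  have "step_val lambdaC V V' \<Longrightarrow> \<exists>E M M'. lambdaC M M' \<and> fill_vctx E M V \<and> fill_vctx E M' V'"
    "step_com lambdaC P P' \<Longrightarrow> \<exists>C M M'. lambdaC M M' \<and> fill_cctx C M P \<and> fill_cctx C M' P'"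
    for V V' P P'
    by (induction rule: step_val_step_com.inducts) (blast intro: fill_vctx_fill_cctx.intros)+
  then show "step_com lambdaC P P' \<Longrightarrow> red P P'"
    by (blast intro: red.intros)
qed

section \<open>Congruence and substitution properties of many-step reduction\<close>

lemma steps_Lam: "(step_com R)\<^sup>*\<^sup>* M M' \<Longrightarrow> (step_val R)\<^sup>*\<^sup>* (Lam M) (Lam M')"
  by (induction rule: rtranclp_induct) (auto intro: step_Lam rtranclp.rtrancl_into_rtrancl)

lemma steps_Unit: "(step_val R)\<^sup>*\<^sup>* V V' \<Longrightarrow> (step_com R)\<^sup>*\<^sup>* (Unit V) (Unit V')"
  by (induction rule: rtranclp_induct) (auto intro: step_Unit rtranclp.rtrancl_into_rtrancl)

lemma steps_Bind:
  assumes "(step_com R)\<^sup>*\<^sup>* M M'" "(step_val R)\<^sup>*\<^sup>* V V'"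
  shows "(step_com R)\<^sup>*\<^sup>* (M \<star> V) (M' \<star> V')"
proof -
  have "(step_com R)\<^sup>*\<^sup>* (M \<star> V) (M' \<star> V)"
    using assms(1)
    by (induction rule: rtranclp_induct) (auto intro: step_BindL rtranclp.rtrancl_into_rtrancl)
  moreover have "(step_com R)\<^sup>*\<^sup>* (M' \<star> V) (M' \<star> V')"
    using assms(2)
    by (induction rule: rtranclp_induct) (auto intro: step_BindR rtranclp.rtrancl_into_rtrancl)
  ultimately show ?thesis by (rule rtranclp_trans)
qed

text \<open>Stability of the root relation under lifting and substitution carries over to its
  closure; both root relations are instances.\<close>

locale substitutive =
  fixes R :: "com \<Rightarrow> com \<Rightarrow> bool"
  assumes root_lift: "R M M' \<Longrightarrow> R (lift_com M k) (lift_com M' k)"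
    and root_subst: "R M M' \<Longrightarrow> R (subst_com M V k) (subst_com M' V k)"
begin

lemma step_lift:
  "step_val R V V' \<Longrightarrow> step_val R (lift_val V k) (lift_val V' k)"
  "step_com R M M' \<Longrightarrow> step_com R (lift_com M k) (lift_com M' k)"
  by (induction arbitrary: k and k rule: step_val_step_com.inducts)
    (auto intro: step_val_step_com.intros root_lift)

lemma step_subst:
  "step_val R V V' \<Longrightarrow> step_val R (subst_val V W k) (subst_val V' W k)"
  "step_com R M M' \<Longrightarrow> step_com R (subst_com M W k) (subst_com M' W k)"
  by (induction arbitrary: k W and k W rule: step_val_step_com.inducts)
    (auto intro: step_val_step_com.intros root_subst)

text \<open>The variable may occur any number of times, so one step in \<open>W\<close> becomes a
  sequence of steps, one for each occurrence.\<close>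

lemma steps_subst_right1:
  "step_val R W W' \<Longrightarrow> (step_val R)\<^sup>*\<^sup>* (subst_val V W k) (subst_val V W' k)"
  "step_val R W W' \<Longrightarrow> (step_com R)\<^sup>*\<^sup>* (subst_com M W k) (subst_com M W' k)"
proof (induct V and M arbitrary: k W W' and k W W')
  case (Lam M)
  from Lam.hyps[OF step_lift(1)[OF Lam.prems]] show ?case
    by (simp add: steps_Lam)
qed (auto intro: steps_Unit steps_Bind)

lemma steps_subst:
  assumes "(step_com R)\<^sup>*\<^sup>* M M'" "(step_val R)\<^sup>*\<^sup>* W W'"
  shows "(step_com R)\<^sup>*\<^sup>* (subst_com M W k) (subst_com M' W' k)"
proof -
  have "(step_com R)\<^sup>*\<^sup>* (subst_com M W k) (subst_com M' W k)"
    using assms(1)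
    by (induction rule: rtranclp_induct) (auto intro: step_subst rtranclp.rtrancl_into_rtrancl)
  moreover have "(step_com R)\<^sup>*\<^sup>* (subst_com M' W k) (subst_com M' W' k)"
    using assms(2)
    by (induction rule: rtranclp_induct) (auto intro: steps_subst_right1 rtranclp_trans)
  ultimately show ?thesis by (rule rtranclp_trans)
qed

end

text \<open>Since \<open>S\<close> closes the diagram in at most one step, \<open>R\<close> must not duplicate
  \<open>S\<close>-redexes, whereas \<open>S\<close> may duplicate \<open>R\<close>-redexes.\<close>

lemma commuting_steps:
  assumes root1: "\<And>M N P. R M N \<Longrightarrow> step_com S M P
      \<Longrightarrow> \<exists>Q. (step_com S)\<^sup>=\<^sup>= N Q \<and> (step_com R)\<^sup>*\<^sup>* P Q"
    and root2: "\<And>M N P. step_com R M N \<Longrightarrow> S M P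
      \<Longrightarrow> \<exists>Q. (step_com S)\<^sup>=\<^sup>= N Q \<and> (step_com R)\<^sup>*\<^sup>* P Q"
  shows "commuting (step_com R)\<^sup>*\<^sup>* (step_com S)\<^sup>*\<^sup>*"
proof (rule commuting_rtranclp)
  have "step_val R V W \<Longrightarrow> step_val S V U
      \<Longrightarrow> \<exists>X. (step_val S)\<^sup>=\<^sup>= W X \<and> (step_val R)\<^sup>*\<^sup>* U X"
    "step_com R M N \<Longrightarrow> step_com S M P
      \<Longrightarrow> \<exists>Q. (step_com S)\<^sup>=\<^sup>= N Q \<and> (step_com R)\<^sup>*\<^sup>* P Q" for V W U M N P
  \<comment> \<open>Induction on the \<open>R\<close>-step. If either step is at the root,
    \<open>root1\<close> or \<open>root2\<close> applies; steps in the same subterm use the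
    induction hypothesis, and steps in different subterms are swapped.\<close>
  proof (induction arbitrary: U and P rule: step_val_step_com.inducts)
    case (step_Lam M M')
    then obtain N where N: "U = Lam N" "step_com S M N" by auto
    then obtain Q where "(step_com S)\<^sup>=\<^sup>= M' Q" "(step_com R)\<^sup>*\<^sup>* N Q"
      using step_Lam.IH(2)[OF N(2)] by (elim exE conjE)
    then have "(step_val S)\<^sup>=\<^sup>= (Lam M') (Lam Q)" "(step_val R)\<^sup>*\<^sup>* U (Lam Q)"
      using N by (auto intro: steps_Lam step_val_step_com.step_Lam)
    then show ?case by (intro exI conjI)
  next
    case (step_root M M')
    then show ?case by (rule root1)
  next
    case (step_Unit V V')
    from step_Unit.prems show ?case
    proof (cases rule: step_UnitE)
      case root
      then show ?thesis by (rule root2[OF step_val_step_com.step_Unit[OF step_Unit.IH(1)]])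
    next
      case (arg U)
      then obtain X where "(step_val S)\<^sup>=\<^sup>= V' X" "(step_val R)\<^sup>*\<^sup>* U X"
        using step_Unit.IH(2)[OF arg(2)] by (elim exE conjE)
      then have "(step_com S)\<^sup>=\<^sup>= (Unit V') (Unit X)" "(step_com R)\<^sup>*\<^sup>* P (Unit X)"
        using arg by (auto intro: steps_Unit step_val_step_com.step_Unit)
      then show ?thesis by (intro exI conjI)
    qed
  next
    case (step_BindL M M' V)
    from step_BindL.prems show ?case
    proof (cases rule: step_BindE)
      case root
      then show ?thesis by (rule root2[OF step_val_step_com.step_BindL[OF step_BindL.IH(1)]])
    next
      case (left N)
      then obtain Q where "(step_com S)\<^sup>=\<^sup>= M' Q" "(step_com R)\<^sup>*\<^sup>* N Q"
        using step_BindL.IH(2)[OF left(2)] by (elim exE conjE)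
      then have "(step_com S)\<^sup>=\<^sup>= (M' \<star> V) (Q \<star> V)" "(step_com R)\<^sup>*\<^sup>* P (Q \<star> V)"
        using left by (auto intro: steps_Bind step_val_step_com.step_BindL)
      then show ?thesis by (intro exI conjI)
    next
      case (right U)
      then have "(step_com S)\<^sup>=\<^sup>= (M' \<star> V) (M' \<star> U)" "(step_com R)\<^sup>*\<^sup>* P (M' \<star> U)"
        using step_BindL.IH(1) by (auto intro: step_val_step_com.intros)
      then show ?thesis by (intro exI conjI)
    qed
  next
    case (step_BindR V V' M)
    from step_BindR.prems show ?case
    proof (cases rule: step_BindE)
      case root
      then show ?thesis by (rule root2[OF step_val_step_com.step_BindR[OF step_BindR.IH(1)]])
    next
      case (left N)
      then have "(step_com S)\<^sup>=\<^sup>= (M \<star> V') (N \<star> V')" "(step_com R)\<^sup>*\<^sup>* P (N \<star> V')"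
        using step_BindR.IH(1) by (auto intro: step_val_step_com.intros)
      then show ?thesis by (intro exI conjI)
    next
      case (right U)
      then obtain X where "(step_val S)\<^sup>=\<^sup>= V' X" "(step_val R)\<^sup>*\<^sup>* U X"
        using step_BindR.IH(2)[OF right(2)] by (elim exE conjE)
      then have "(step_com S)\<^sup>=\<^sup>= (M \<star> V') (M \<star> X)" "(step_com R)\<^sup>*\<^sup>* P (M \<star> X)"
        using right by (auto intro: steps_Bind step_val_step_com.step_BindR)
      then show ?thesis by (intro exI conjI)
    qed
  qed
  then show "step_com R M N \<Longrightarrow> step_com S M P
      \<Longrightarrow> \<exists>Q. (step_com S)\<^sup>=\<^sup>= N Q \<and> (step_com R)\<^sup>*\<^sup>* P Q" for M N P
    by blast
qed

section \<open>Confluence of \<open>\<beta>\<^sub>c \<union> id\<close>\<close>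

inductive beta_id :: "com \<Rightarrow> com \<Rightarrow> bool" where
  beta: "beta_id (Unit V \<star> Lam M) (subst_com M V 0)"
| id: "beta_id (M \<star> Lam (Unit (Var 0))) M"

interpretation beta_id: substitutive beta_id
proof
  show "beta_id (lift_com M k) (lift_com M' k)" if "beta_id M M'" for M M' k
    using that by cases (auto simp: lift_subst intro: beta_id.intros)
  show "beta_id (subst_com M V k) (subst_com M' V k)" if "beta_id M M'" for M M' V k
    using that by cases (auto simp: subst_subst[symmetric] intro: beta_id.intros)
qed

abbreviation "bi \<equiv> step_com beta_id"
abbreviation "biv \<equiv> step_val beta_id"

lemma beta_id_not_Unit [simp]: "\<not> beta_id (Unit V) M"
  by (auto elim: beta_id.cases)

lemma bi_UnitE [elim!]: "bi (Unit V) P \<Longrightarrow> (\<And>V'. P = Unit V' \<Longrightarrow> biv V V' \<Longrightarrow> Q) \<Longrightarrow> Q"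
  by (auto elim: step_UnitE)

text \<open>On \<open>unit W \<star> \<lambda>x.unit x\<close> the rules beta and id agree, so the
  first clause covers that overlap. In the last clause the left side is a binding, so only id can
  apply at the root.\<close>

fun contract :: "com \<Rightarrow> val \<Rightarrow> com" where
  "contract (Unit W) (Lam N) = subst_com N W 0"
| "contract (Unit W) (Var i) = Unit W \<star> Var i"
| "contract (M \<star> W) V = (if V = Lam (Unit (Var 0)) then M \<star> W else M \<star> W \<star> V)"

text \<open>A superdevelopment: redexes that arise at a binding once its parts are developed are
  contracted too.\<close>

primrec dev_val :: "val \<Rightarrow> val" and dev_com :: "com \<Rightarrow> com" where
  "dev_val (Var i) = Var i"
| "dev_val (Lam M) = Lam (dev_com M)"
| "dev_com (Unit V) = Unit (dev_val V)"
| "dev_com (M \<star> V) = contract (dev_com M) (dev_val V)"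

lemma contract_id: "contract M (Lam (Unit (Var 0))) = M"
  by (cases M) auto

lemma bind_bi_contract: "bi\<^sup>*\<^sup>* (M \<star> V) (contract M V)"
  by (cases "(M, V)" rule: contract.cases)
    (auto intro!: r_into_rtranclp step_root intro: beta_id.intros)

lemma contract_left:
  assumes "bi M M'"
  shows "bi\<^sup>*\<^sup>* (contract M V) (contract M' V)"
proof (cases "V = Lam (Unit (Var 0))")
  case True
  then show ?thesis using assms by (simp add: contract_id)
next
  case False
  show ?thesis
  proof (cases M)
    case (Unit W)
    then obtain W' where "M' = Unit W'" "biv W W'" using assms by auto
    then show ?thesis using Unit
      by (cases V) (auto intro: beta_id.steps_subst_right1 step_val_step_com.intros)
  next
    case (Bind L W)
    \<comment> \<open>Here \<open>contract M V\<close> is just \<open>M \<star> V\<close>. The step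
      may turn \<open>M\<close> into a unit and create a root redex, which
      \<open>bind_bi_contract\<close> then contracts.\<close>
    then have "bi\<^sup>*\<^sup>* (contract M V) (M' \<star> V)"
      using False assms by (auto intro: step_BindL)
    then show ?thesis using bind_bi_contract by (rule rtranclp_trans)
  qed
qed

lemma contract_right:
  assumes "biv V V'"
  shows "bi\<^sup>*\<^sup>* (contract M V) (contract M V')"
proof (cases M)
  case (Unit W)
  then show ?thesis using assms
    by (cases V) (auto intro!: r_into_rtranclp[of bi] beta_id.step_subst)
next
  case (Bind L W)
  \<comment> \<open>The identity abstraction is normal, so \<open>contract M V\<close> is the plain
    binding; if \<open>V'\<close> has become the identity, the final contraction is an
    id-step.\<close>
  have "V \<noteq> Lam (Unit (Var 0))" using assms by auto
  then have "bi\<^sup>*\<^sup>* (contract M V) (M \<star> V')"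
    using Bind assms by (auto intro: step_BindR)
  then show ?thesis using bind_bi_contract by (rule rtranclp_trans)
qed

lemma contract_mono:
  assumes "bi\<^sup>*\<^sup>* M M'" "biv\<^sup>*\<^sup>* V V'"
  shows "bi\<^sup>*\<^sup>* (contract M V) (contract M' V')"
proof -
  have "bi\<^sup>*\<^sup>* (contract M V) (contract M' V)"
    using assms(1) by (induction rule: rtranclp_induct) (auto intro: contract_left rtranclp_trans)
  moreover have "bi\<^sup>*\<^sup>* (contract M' V) (contract M' V')"
    using assms(2) by (induction rule: rtranclp_induct) (auto intro: contract_right rtranclp_trans)
  ultimately show ?thesis by (rule rtranclp_trans)
qed

lemma lift_eq_id:
  "lift_val V k = Lam (Unit (Var 0)) \<longleftrightarrow> V = Lam (Unit (Var 0))"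
  by (cases V; simp; rename_tac M; case_tac M; simp; rename_tac W; case_tac W; simp)

lemma lift_contract: "lift_com (contract M V) k = contract (lift_com M k) (lift_val V k)"
  by (cases "(M, V)" rule: contract.cases) (auto simp: lift_subst lift_eq_id)

lemma dev_lift:
  "dev_val (lift_val V k) = lift_val (dev_val V) k"
  "dev_com (lift_com M k) = lift_com (dev_com M) k"
  by (induct V and M arbitrary: k and k) (auto simp: lift_contract)

text \<open>Substitution can turn a variable in function position into an abstraction, creating a
  redex that only the right-hand side contracts. Hence a reduction and not an equation.\<close>

lemma subst_contract:
  "bi\<^sup>*\<^sup>* (subst_com (contract M V) W k) (contract (subst_com M W k) (subst_val V W k))"
proof (cases "(M, V)" rule: contract.cases)
  case (1 U N)
  then show ?thesis by (simp add: subst_subst)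
next
  case (2 U i)
  then show ?thesis using bind_bi_contract by (auto split: if_splits)
next
  case (3 L U V')
  then show ?thesis
    using bind_bi_contract[of "subst_com M W k" "subst_val V W k"] by (auto simp: contract_id)
qed

lemma subst_dev:
  "biv\<^sup>*\<^sup>* (subst_val (dev_val V) (dev_val W) k) (dev_val (subst_val V W k))"
  "bi\<^sup>*\<^sup>* (subst_com (dev_com M) (dev_val W) k) (dev_com (subst_com M W k))"
proof (induct V and M arbitrary: k W and k W)
  case (Bind M V)
  from contract_mono[OF Bind] show ?case
    by (auto intro: rtranclp_trans[OF subst_contract])
qed (auto simp: dev_lift[symmetric] intro: steps_Lam steps_Unit)

lemma bi_dev: "biv\<^sup>*\<^sup>* V (dev_val V)" "bi\<^sup>*\<^sup>* M (dev_com M)"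
  by (induct V and M)
    (auto intro: steps_Lam steps_Unit rtranclp_trans[OF steps_Bind bind_bi_contract])

text \<open>First half of the Z property. A root beta-redex develops to the substitution of its
  developed parts, which the contractum reaches by reducing inside body and argument.\<close>

lemma dev_upper:
  "biv V V' \<Longrightarrow> biv\<^sup>*\<^sup>* V' (dev_val V)"
  "bi M M' \<Longrightarrow> bi\<^sup>*\<^sup>* M' (dev_com M)"
proof (induction rule: step_val_step_com.inducts)
  case (step_root M M')
  then show ?case
    by cases (auto simp: contract_id intro: beta_id.steps_subst bi_dev)
qed (auto intro: steps_Lam steps_Unit bi_dev rtranclp_trans[OF steps_Bind bind_bi_contract])

text \<open>Second half of the Z property. The root beta case is \<open>subst_dev\<close>; elsewhere
  monotonicity of \<open>contract\<close> suffices.\<close>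

lemma dev_mono:
  "biv V V' \<Longrightarrow> biv\<^sup>*\<^sup>* (dev_val V) (dev_val V')"
  "bi M M' \<Longrightarrow> bi\<^sup>*\<^sup>* (dev_com M) (dev_com M')"
proof (induction rule: step_val_step_com.inducts)
  case (step_root M M')
  then show ?case
    by cases (auto simp: contract_id intro: subst_dev)
qed (auto intro: steps_Lam steps_Unit contract_mono)

lemma confluent_beta_id: "commuting bi\<^sup>*\<^sup>* bi\<^sup>*\<^sup>*"
  by (rule commuting_if_Z[where f = dev_com]) (rule dev_upper dev_mono, assumption)+

section \<open>Confluence of \<open>ass\<close>\<close>

inductive assoc :: "com \<Rightarrow> com \<Rightarrow> bool" where
  "assoc ((L \<star> Lam M) \<star> Lam N) (L \<star> Lam (M \<star> Lam (lift_com N 1)))"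

lemma lift_lift_one: "lift_com (lift_com N 1) (Suc (Suc k)) = lift_com (lift_com N (Suc k)) 1"
  by (simp add: lift_lift)

lemma subst_lift_one:
  "subst_com (lift_com N 1) (lift_val (lift_val V 0) 0) (Suc (Suc k))
    = lift_com (subst_com N (lift_val V 0) (Suc k)) 1"
  using lift_subst_lt(2)[of 1 "Suc k" N "lift_val V 0"] lift_lift(1)[of 0 0 V] by simp

interpretation assoc: substitutive assoc
proof
  show "assoc (lift_com M k) (lift_com M' k)" if "assoc M M'" for M M' k
    using that by cases (use assoc.intros in \<open>simp add: lift_lift_one[simplified]\<close>)
  show "assoc (subst_com M V k) (subst_com M' V k)" if "assoc M M'" for M M' V k
    using that by cases (use assoc.intros in \<open>simp add: subst_lift_one[simplified]\<close>)
qed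

abbreviation "as \<equiv> step_com assoc"

text \<open>The associative normal form of \<open>M \<star> Lam N\<close>, for \<open>M\<close> and \<open>N\<close> in associative normal form.\<close>

fun graft :: "com \<Rightarrow> com \<Rightarrow> com" where
  "graft (L \<star> Lam M) N = L \<star> Lam (graft M (lift_com N 1))"
| "graft (L \<star> Var i) N = L \<star> Var i \<star> Lam N"
| "graft (Unit W) N = Unit W \<star> Lam N"

primrec anf_val :: "val \<Rightarrow> val" and anf_com :: "com \<Rightarrow> com" where
  "anf_val (Var i) = Var i"
| "anf_val (Lam M) = Lam (anf_com M)"
| "anf_com (Unit V) = Unit (anf_val V)"
| "anf_com (M \<star> V) =
    (case anf_val V of Var i \<Rightarrow> anf_com M \<star> Var i | Lam N \<Rightarrow> graft (anf_com M) N)"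

lemma lift_graft: "lift_com (graft M N) k = graft (lift_com M k) (lift_com N (Suc k))"
  by (induction M N arbitrary: k rule: graft.induct) (auto simp: lift_lift_one[simplified])

text \<open>\<open>graft A B\<close> appends \<open>B\<close> at the end of the spine of
  \<open>A\<close>, and appending is associative. The lift is the one in rule ass, so the two sides
  are the normal forms of an ass-redex and its contractum.\<close>

lemma graft_assoc: "graft (graft A B) C = graft A (graft B (lift_com C 1))"
  by (induction A B arbitrary: C rule: graft.induct) (auto simp: lift_graft lift_lift)

lemma anf_lift:
  "anf_val (lift_val V k) = lift_val (anf_val V) k"
  "anf_com (lift_com M k) = lift_com (anf_com M) k"
  by (induct V and M arbitrary: k and k) (auto simp: lift_graft split: val.splits)

lemma as_graft: "as\<^sup>*\<^sup>* (M \<star> Lam N) (graft M N)"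
proof (induction M N rule: graft.induct)
  case (1 L M N)
  have "as (L \<star> Lam M \<star> Lam N) (L \<star> Lam (M \<star> Lam (lift_com N 1)))"
    by (intro step_root assoc.intros)
  also have "as\<^sup>*\<^sup>* \<dots> (L \<star> Lam (graft M (lift_com N 1)))"
    using 1 by (intro steps_Bind steps_Lam) auto
  finally show ?case by simp
qed auto

lemma as_anf: "(step_val assoc)\<^sup>*\<^sup>* V (anf_val V)" "as\<^sup>*\<^sup>* M (anf_com M)"
proof (induct V and M)
  case (Bind M V)
  then have "as\<^sup>*\<^sup>* (M \<star> V) (anf_com M \<star> anf_val V)" by (rule steps_Bind)
  then show ?case using as_graft by (auto split: val.splits intro: rtranclp_trans)
qed (auto intro: steps_Lam steps_Unit)

lemma anf_invariant:
  "step_val assoc V V' \<Longrightarrow> anf_val V = anf_val V'"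
  "as M M' \<Longrightarrow> anf_com M = anf_com M'"
proof (induction rule: step_val_step_com.inducts)
  case (step_root M M')
  then show ?case by cases (simp add: graft_assoc anf_lift)
qed (auto split: val.split)

lemma confluent_assoc: "commuting as\<^sup>*\<^sup>* as\<^sup>*\<^sup>*"
  \<comment> \<open>Invariance makes the second Z condition reflexive and reduces the first to
    \<open>as_anf\<close> for the reduct.\<close>
  by (rule commuting_if_Z[where f = anf_com]) (simp_all add: anf_invariant as_anf)

section \<open>Commutation\<close>

lemma as_UnitE [elim!]:
  "as (Unit V) P \<Longrightarrow> (\<And>V'. P = Unit V' \<Longrightarrow> step_val assoc V V' \<Longrightarrow> Q) \<Longrightarrow> Q"
  by (auto elim: step_UnitE assoc.cases)

text \<open>Closes the critical pair of ass with an outer id-redex: ass moves that redex under the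
  first binder, where it is still an id-redex.\<close>

lemma bi_id_under_Bind: "bi (L \<star> Lam (M \<star> Lam (Unit (Var 0)))) (L \<star> Lam M)"
  by (intro step_BindR step_Lam step_root[of beta_id, OF beta_id.id])

text \<open>Case analysis on the position of the other redex. In an overlap a single beta- or
  id-step from \<open>N\<close> already gives \<open>P\<close>; inside \<open>A\<close>,
  \<open>B\<close> or \<open>C\<close> the same step is made in \<open>N\<close> and the ass-redex
  survives in \<open>P\<close>.\<close>

lemma assoc_root_commutes:
  assumes "assoc M N" "bi M P"
  shows "\<exists>Q. bi\<^sup>=\<^sup>= N Q \<and> as\<^sup>*\<^sup>* P Q"
  using assms(1)
proof cases
  case (1 A B C)
  let ?C = "lift_com C 1"
  have asI: "as\<^sup>*\<^sup>* (A' \<star> Lam B' \<star> Lam C') (A' \<star> Lam (B' \<star> Lam (lift_com C' 1)))" for A' B' C'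
    by (intro r_into_rtranclp step_root assoc.intros)
  have "bi (A \<star> Lam B \<star> Lam C) P" using assms 1 by simp
  then show ?thesis
  proof (cases rule: step_BindE)
    case root
    then have "bi N P"
    proof (cases rule: beta_id.cases)
      case id
      then show ?thesis using \<open>N = _\<close> by (simp add: bi_id_under_Bind)
    qed
    then show ?thesis by auto
  next
    case (left D)
    note P = this(1)
    from \<open>bi (A \<star> Lam B) D\<close> show ?thesis
    proof (cases rule: step_BindE)
      case root
      then show ?thesis
      proof (cases rule: beta_id.cases)
        case (beta V)
        \<comment> \<open>The beta-redex now has \<open>?C\<close> in its body; substitution at
          index 1 cancels the lift there and restores \<open>C\<close>.\<close>
        have "bi N (subst_com (B \<star> Lam ?C) V 0)"
          using beta \<open>N = _\<close> by (auto intro: step_root beta_id.beta simp del: subst_com.simps)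
        moreover have "subst_com (B \<star> Lam ?C) V 0 = P"
          using beta P by simp
        ultimately show ?thesis by auto
      next
        case id
        \<comment> \<open>Here \<open>B\<close> is \<open>unit x\<close>, so ass has turned the
          id-redex into the beta-redex \<open>unit x \<star> \<lambda>y.C\<close>, which renames
          \<open>y\<close> to \<open>x\<close>.\<close>
        have "bi (Unit (Var 0) \<star> Lam ?C) (subst_com ?C (Var 0) 0)"
          by (intro step_root beta_id.beta)
        then have "bi N P"
          using id \<open>N = _\<close> P subst_lift_var_same(2)[of C 0] by (auto intro!: step_BindR step_Lam)
        then show ?thesis by auto
      qed
    next
      case (left A')
      then have "bi N (A' \<star> Lam (B \<star> Lam ?C))"
        using \<open>N = _\<close> by (simp add: step_BindL)
      then show ?thesis using left P asI[of A' B C] by auto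
    next
      case (right W)
      then obtain B' where "W = Lam B'" "bi B B'" by auto
      moreover from this have "bi N (A \<star> Lam (B' \<star> Lam ?C))"
        using \<open>N = _\<close> by (simp add: step_BindL step_BindR step_Lam)
      ultimately show ?thesis using right P asI[of A B' C] by auto
    qed
  next
    case (right W)
    then obtain C' where "W = Lam C'" "bi C C'" by auto
    moreover from this have "bi ?C (lift_com C' 1)" by (intro beta_id.step_lift)
    then have "bi N (A \<star> Lam (B \<star> Lam (lift_com C' 1)))"
      using \<open>N = _\<close> by (simp add: step_BindR step_Lam)
    ultimately show ?thesis using right asI[of A B C'] by auto
  qed
qed

lemma beta_id_root_commutes:
  assumes "as M N" "beta_id M P"
  shows "\<exists>Q. bi\<^sup>=\<^sup>= N Q \<and> as\<^sup>*\<^sup>* P Q"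
  using assms(2)
proof cases
  case (beta V B)
  then have "as (Unit V \<star> Lam B) N" using assms by simp
  then show ?thesis
  proof (cases rule: step_BindE)
    case root
    then show ?thesis by (cases rule: assoc.cases)
  next
    case (left M')
    then obtain V' where V': "M' = Unit V'" "step_val assoc V V'" by auto
    \<comment> \<open>Beta may copy or erase \<open>V\<close>, so the ass-step inside it becomes a
      sequence; the other side still needs one beta-step.\<close>
    then have "as\<^sup>*\<^sup>* P (subst_com B V' 0)" using beta by (auto intro: assoc.steps_subst_right1)
    then show ?thesis using left V' by (blast intro: step_root beta_id.beta)
  next
    case (right W)
    then obtain B' where B': "W = Lam B'" "as B B'" by auto
    then have "as P (subst_com B' V 0)" using beta by (auto intro: assoc.step_subst)
    then show ?thesis using right B' by (blast intro: step_root beta_id.beta)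
  qed
next
  case id
  then have "as (P \<star> Lam (Unit (Var 0))) N" using assms by simp
  then show ?thesis
  proof (cases rule: step_BindE)
    case root
    \<comment> \<open>The left side of the id-redex is itself a binding with an abstraction: the
      critical pair of ass and id again.\<close>
    then have "bi N P"
      by (cases rule: assoc.cases) (simp add: bi_id_under_Bind)
    then show ?thesis by auto
  next
    case (left M')
    then show ?thesis by (blast intro: step_root beta_id.id)
  next
    case (right W)
    then show ?thesis by auto
  qed
qed

lemma commuting_assoc_beta_id: "commuting as\<^sup>*\<^sup>* bi\<^sup>*\<^sup>*"
  by (rule commuting_steps) (rule assoc_root_commutes beta_id_root_commutes, assumption+)+

section \<open>Assembling the Church-Rosser property from the two parts of the reduction\<close>

lemma lambdaC_eq: "lambdaC = sup assoc beta_id"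
  by (auto simp: fun_eq_iff lambdaC.simps assoc.simps beta_id.simps)

theorem mainTheorem1:
  fixes M N L :: com
  assumes "M \<longlongrightarrow>\<^sub>c* N" and "M \<longlongrightarrow>\<^sub>c* L"
  shows "\<exists>M' :: com. N \<longlongrightarrow>\<^sub>c* M' \<and> L \<longlongrightarrow>\<^sub>c* M'"
proof -
  have "commuting reds reds"
    unfolding red_eq_step lambdaC_eq step_sup
    by (intro Hindley_Rosen confluent_assoc confluent_beta_id commuting_assoc_beta_id)
  then show ?thesis using assms by (rule commutingD)
qed

end
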